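(* For every positive integer $m$, $$\hat\eta_{1/4}(m+1)-\eta_{1/4}(m)=\tfrac12 h^{c(m+3,m+2)}_{5,3},\qquad \hat\eta_{1/4}(m+1)-\hat\eta_{1/4}(m)=\tfrac12 h^{c(m+3,m+2)}_{5,5}.$$
   Context: For a scalar $\alpha$, $\eta_\alpha(m)=\dfrac{\alpha m}{2+2\alpha(m-2)}$ and $\hat\eta_\alpha(m)=\dfrac{\alpha(m-1)}{1+\alpha(m-2)}$, so $\eta_{1/4}(m)=\dfrac{m}{2(m+2)}$ and $\hat\eta_{1/4}(m)=\dfrac{m-1}{m+2}$. For coprime integers $p,q\ge 2$, $c(p,q)=1-\frac{6(p-q)^2}{pq}$, and $$h^{c(p,q)}_{r,s}=\frac{(sp-rq)^2-(p-q)^2}{4pq},$$ which for $1\le r<p$, $1\le s<q$ are the possible highest weights of irreducible modules of the Virasoro algebra of central charge $c(p,q)$. Here $h^{c(p,q)}_{r,s}$ denotes the value of this formula (with $p=m+3$, $q=m+2$ in this order) for the given indices $r,s$. *)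

theory Defs
  imports Complex_Main
begin

text \<open>
  The scalar \<open>\<alpha>\<close> ranges over an arbitrary field of characteristic 0, into which
  the integer arguments are embedded before any subtraction takes place.
\<close>

definition eta :: "'a::field_char_0 \<Rightarrow> nat \<Rightarrow> 'a" where
  "eta \<alpha> m = \<alpha> * of_nat m / (2 + 2 * \<alpha> * (of_nat m - 2))"

definition eta_hat :: "'a::field_char_0 \<Rightarrow> nat \<Rightarrow> 'a" where
  "eta_hat \<alpha> m = \<alpha> * (of_nat m - 1) / (1 + \<alpha> * (of_nat m - 2))"

text \<open>
  The number \<open>h\<^sub>r\<^sub>,\<^sub>s\<close> attached to the central charge \<open>c(p,q) = 1 - 6 (p - q)^2 / (p q)\<close>.
  Since \<open>c(p,q) = c(q,p)\<close> whereas the formula for \<open>h\<^sub>r\<^sub>,\<^sub>s\<close> depends on the order of \<open>p\<close>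
  and \<open>q\<close>, it is a function of the pair \<open>(p,q)\<close> rather than of the value \<open>c(p,q)\<close>.
  The indices are not restricted to \<open>1 \<le> r < p\<close>, \<open>1 \<le> s < q\<close>.
\<close>

definition virasoro_h :: "nat \<Rightarrow> nat \<Rightarrow> nat \<Rightarrow> nat \<Rightarrow> 'a::field_char_0" where
  "virasoro_h p q r s =
     ((of_nat s * of_nat p - of_nat r * of_nat q)^2 - (of_nat p - of_nat q)^2)
       / (4 * of_nat p * of_nat q)"

end

theory Submission
  imports Defs
begin

text \<open>At \<open>1/4\<close> the factor 1/4 cancels from each quotient, so with x the image of
  \<open>m\<close> in the field everything is a rational function of x with denominators built from
  x + 2 and x + 3. For p = x + 3 and q = x + 2 we have p - q = 1, so the numerator of h is a square
  minus 1. Both identities then compare numerators over (x + 2)(x + 3): x(2(x + 2) - (x + 3)) = x(x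
  + 1) for the first, and x(x + 2) - (x - 1)(x + 3) = 3 for the second.\<close>

lemma eta_quarter: "eta (1/4) m = (of_nat m / (2 * (of_nat m + 2)) :: 'a::field_char_0)"
proof -
  have denom: "(2 + 2 * (1/4) * (of_nat m - 2) :: 'a) = (2 * (of_nat m + 2)) / 4"
    by (simp add: field_simps)
  show ?thesis unfolding eta_def denom by simp
qed

lemma eta_hat_quarter:
  "eta_hat (1/4) m = ((of_nat m - 1) / (of_nat m + 2) :: 'a::field_char_0)"
proof -
  have denom: "(1 + (1/4) * (of_nat m - 2) :: 'a) = (of_nat m + 2) / 4"
    by (simp add: field_simps)
  show ?thesis unfolding eta_hat_def denom
    by (simp del: left_diff_distrib_numeral right_diff_distrib_numeral
        distrib_left_numeral distrib_right_numeral)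
qed

theorem mainTheorem4:
  fixes m :: nat
  assumes "m \<ge> 1"
  shows "eta_hat (1/4) (m + 1) - eta (1/4) m
           = (1/2 * virasoro_h (m + 3) (m + 2) 5 3 :: 'a::field_char_0)
       \<and> eta_hat (1/4) (m + 1) - eta_hat (1/4) m
           = (1/2 * virasoro_h (m + 3) (m + 2) 5 5 :: 'a::field_char_0)"
proof -
  define x :: 'a where "x = of_nat m"
  \<comment> \<open>Characteristic 0 enters here: it keeps positive integers nonzero in the field,
    which allows the denominators to be cleared later.\<close>
  have "(of_nat (m + 2) :: 'a) \<noteq> 0" "(of_nat (m + 3) :: 'a) \<noteq> 0"
    by (simp_all only: of_nat_eq_0_iff)
  then have nz: "x + 2 \<noteq> 0" "x + 3 \<noteq> 0"
    by (simp_all add: x_def add.commute)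
  have eta: "eta (1/4) m = x / (2 * (x + 2))"
    and eta_hat: "eta_hat (1/4) m = (x - 1) / (x + 2)"
    by (simp_all add: eta_quarter eta_hat_quarter x_def)
  have eta_hat_Suc: "eta_hat (1/4) (m + 1) = x / (x + 3)"
    by (simp add: eta_hat_quarter x_def add.commute)
  have "virasoro_h (m + 3) (m + 2) 5 3
      = ((3 * (x + 3) - 5 * (x + 2))\<^sup>2 - ((x + 3) - (x + 2))\<^sup>2) / (4 * (x + 3) * (x + 2))"
    by (simp only: virasoro_h_def x_def of_nat_add of_nat_numeral)
  \<comment> \<open>The first base is -(2x + 1), and (2x + 1)^2 - 1 = 2x(2x + 2).\<close>
  also have "(3 * (x + 3) - 5 * (x + 2))\<^sup>2 - ((x + 3) - (x + 2))\<^sup>2 = 4 * (x * (x + 1))"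
    by (simp add: power2_eq_square algebra_simps)
  also have "4 * (x * (x + 1)) / (4 * (x + 3) * (x + 2)) = x * (x + 1) / ((x + 3) * (x + 2))"
    unfolding mult.assoc by (rule mult_divide_mult_cancel_left) simp
  finally have h53: "virasoro_h (m + 3) (m + 2) 5 3 = x * (x + 1) / ((x + 3) * (x + 2))" .
  have "virasoro_h (m + 3) (m + 2) 5 5
      = ((5 * (x + 3) - 5 * (x + 2))\<^sup>2 - ((x + 3) - (x + 2))\<^sup>2) / (4 * (x + 3) * (x + 2))"
    by (simp only: virasoro_h_def x_def of_nat_add of_nat_numeral)
  \<comment> \<open>For r = s = 5 the base is 5(p - q) = 5, so the numerator is the constant 25 -
    1.\<close>
  also have "(5 * (x + 3) - 5 * (x + 2))\<^sup>2 - ((x + 3) - (x + 2))\<^sup>2 = 4 * 6"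
    by (simp add: power2_eq_square algebra_simps)
  also have "4 * 6 / (4 * (x + 3) * (x + 2)) = 6 / ((x + 3) * (x + 2))"
    unfolding mult.assoc by (rule mult_divide_mult_cancel_left) simp
  finally have h55: "virasoro_h (m + 3) (m + 2) 5 5 = 6 / ((x + 3) * (x + 2))" .
  \<comment> \<open>The distributive rules stay off while denominators are cleared, so that 2(x + 2)
    keeps the factor x + 2 that \<open>nz\<close> knows to be nonzero.\<close>
  have "x / (x + 3) - x / (2 * (x + 2)) = 1/2 * (x * (x + 1) / ((x + 3) * (x + 2)))"
    using nz by (simp add: divide_simps del: distrib_left_numeral distrib_right_numeral) (simp add: algebra_simps)
  moreover have "x / (x + 3) - (x - 1) / (x + 2) = 1/2 * (6 / ((x + 3) * (x + 2)))"
    using nz by (simp add: divide_simps) (simp add: algebra_simps)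
  ultimately show ?thesis
    by (simp only: eta eta_hat eta_hat_Suc h53 h55)
qed

end
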